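(* Let $q>2$ be a prime power and let $n=\frac{(h-1)(q^2-1)}{h}$, where $h\mid(q+1)$ and $h\ge2$. Let $t$ be an integer with $1\le t\le\lceil\frac{n}{2q}\rceil$, and let the integers $k,l$ satisfy one of: - $(t-1)q+1\le k\le tq-t-\frac{(h-1)(q+1)}{h}+1$ and $l=k-2(t-1)^2$; - $tq-t-\frac{(h-1)(q+1)}{h}+2\le k\le tq-\frac{(h-1)(q+1)}{h}$ and $l=2tq+2t-2t^2-k-\frac{2(h-1)(q+1)}{h}$; - $tq-\frac{(h-1)(q+1)}{h}+1\le k\le tq-t$ and $l=k+2t-2t^2$; - $tq-t+1\le k\le tq$ and $l=2tq-2t^2-k$. Then for each integer $0\le s\le l$ there exists an $[n,k]_{q^2}$ MDS code with $s$-dimensional Hermitian hull.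
   Context: For a linear code $\mathcal C\subseteq\mathbb F_{q^2}^n$, $\mathcal C^{\perp_H}=\{\bm x:\sum_i y_ix_i^q=0\ \text{for all }\bm y\in\mathcal C\}$, and the Hermitian hull is $\mathrm{Hull}_H(\mathcal C)=\mathcal C\cap\mathcal C^{\perp_H}$. An $[n,k]_{q^2}$ code is a $k$-dimensional subspace of $\mathbb F_{q^2}^n$; it is MDS if its minimum distance is $n-k+1$. *)

theory Defs
  imports "HOL-Analysis.Cartesian_Space" "HOL-Number_Theory.Prime_Powers"
begin

definition hamming_distance :: "'a ^ 'n \<Rightarrow> 'a ^ 'n::finite \<Rightarrow> nat" where
  "hamming_distance x y = card {i. x $ i \<noteq> y $ i}"

text \<open>The minimum is taken over a finite set; it is meaningful only for codes with at
  least two words, so the minimum distance of the zero code is left unspecified.\<close>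

definition minimum_distance :: "('a ^ 'n::finite) set \<Rightarrow> nat" where
  "minimum_distance C = Min {hamming_distance x y |x y. x \<in> C \<and> y \<in> C \<and> x \<noteq> y}"

definition linear_code :: "nat \<Rightarrow> nat \<Rightarrow> ('a::field ^ 'n::finite) set \<Rightarrow> bool" where
  "linear_code n k C \<longleftrightarrow> CARD('n) = n \<and> vec.subspace C \<and> vec.dim C = k"

text \<open>The subtraction on natural numbers does not truncate, because \<open>k \<le> n\<close> for every
  \<open>k\<close>-dimensional code of length \<open>n\<close>.\<close>

definition MDS_code :: "nat \<Rightarrow> nat \<Rightarrow> ('a::field ^ 'n::finite) set \<Rightarrow> bool" where
  "MDS_code n k C \<longleftrightarrow> linear_code n k C \<and> minimum_distance C = n - k + 1"

text \<open>The parameter \<open>q\<close> gives the conjugation \<open>x \<mapsto> x ^ q\<close>; it is meant to be used when the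
  field has \<open>q\<^sup>2\<close> elements.\<close>

definition hermitian_dual :: "nat \<Rightarrow> ('a::field ^ 'n::finite) set \<Rightarrow> ('a ^ 'n) set" where
  "hermitian_dual q C = {x. \<forall>y\<in>C. (\<Sum>i\<in>UNIV. y $ i * (x $ i) ^ q) = 0}"

definition hermitian_hull :: "nat \<Rightarrow> ('a::field ^ 'n::finite) set \<Rightarrow> ('a ^ 'n) set" where
  "hermitian_hull q C = C \<inter> hermitian_dual q C"

text \<open>The admissible pairs \<open>k\<close>, \<open>l\<close> for given \<open>q\<close>, \<open>h\<close>, \<open>t\<close>. All quantities are
  integers: \<open>l\<close> may be negative, and the integer division is exact when \<open>h\<close> divides
  \<open>q + 1\<close>.\<close>

definition hull_parameters :: "int \<Rightarrow> int \<Rightarrow> int \<Rightarrow> int \<Rightarrow> int \<Rightarrow> bool" where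
  "hull_parameters q h t k l \<longleftrightarrow>
     (let a = (h - 1) * (q + 1) div h in
        ((t - 1) * q + 1 \<le> k \<and> k \<le> t * q - t - a + 1 \<and>
           l = k - 2 * (t - 1)\<^sup>2) \<or>
        (t * q - t - a + 2 \<le> k \<and> k \<le> t * q - a \<and>
           l = 2 * t * q + 2 * t - 2 * t\<^sup>2 - k - 2 * a) \<or>
        (t * q - a + 1 \<le> k \<and> k \<le> t * q - t \<and>
           l = k + 2 * t - 2 * t\<^sup>2) \<or>
        (t * q - t + 1 \<le> k \<and> k \<le> t * q \<and>
           l = 2 * t * q - 2 * t\<^sup>2 - k))"

end

theory Submission
  imports Defs "HOL-Computational_Algebra.Polynomial" "HOL-Number_Theory.Residues"
begin

text \<open>
  Write \<open>q + 1 = h r\<close> and \<open>m = (q - 1) r\<close>. Evaluate at the \<open>n\<close> nonzero points \<open>x\<close> with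
  \<open>x\<^sup>m \<noteq> 1\<close>, using column multipliers whose norm is \<open>\<theta> x\<^sup>r (x\<^sup>m - 1)\<close> with
  \<open>\<theta>\<close> of \<open>(q - 1)\<close>-st power \<open>-1\<close>; these values lie in the subfield of \<open>q\<close> elements because
  \<open>x\<^sup>m\<close> has norm \<open>1\<close>. They vanish at the excluded points, so the Hermitian product of the words
  of \<open>x\<^sup>i\<close> and \<open>x\<^sup>j\<close> is a difference of two power sums over all nonzero field elements, and it
  is nonzero only if \<open>q\<^sup>2 - 1\<close> divides \<open>i + q j + r\<close> or \<open>j + q i + r\<close>. Counting these pairs
  by their \<open>q\<close>-adic digits shows that at least \<open>l\<close> monomials lie in the hull. Finally, scaling a
  coordinate in which some hull vector is nonzero by an element of norm different from \<open>1\<close> lowers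
  the dimension of the hull by exactly one and preserves the MDS property.
\<close>

section \<open>Powers in finite fields\<close>

text \<open>Multiplication by \<open>x\<close> permutes the nonzero elements, so it preserves their
  product, which is nonzero and cancels.\<close>

lemma field_power_card_minus_one:
  fixes x :: "'a::{field,finite}"
  assumes "x \<noteq> 0"
  shows "x ^ (CARD('a) - 1) = 1"
proof -
  have "x ^ (CARD('a) - 1) * \<Prod>(-{0::'a}) = (\<Prod>y\<in>-{0}. x * y)"
    by (simp add: prod.distrib Compl_eq_Diff_UNIV card_Diff_singleton)
  also have "\<dots> = \<Prod>(-{0})"
    by (rule prod.reindex_bij_witness[of _ "\<lambda>y. y / x" "\<lambda>y. x * y"]) (use assms in auto)
  finally show ?thesis
    by (simp add: prod_zero_iff)
qed

lemma field_power_card: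
  fixes x :: "'a::{field,finite}"
  shows "x ^ CARD('a) = x"
proof (cases "x = 0")
  case False
  have "x ^ CARD('a) = x ^ (CARD('a) - 1) * x"
    by (simp flip: power_Suc2)
  then show ?thesis using field_power_card_minus_one[OF False] by simp
qed (simp add: power_0_left)

lemma card_power_eq_le:
  fixes c :: "'a::idom"
  assumes "d > 0"
  shows "card {x. x ^ d = c} \<le> d"
proof -
  define p where "p = Polynomial.monom 1 d - [:c:]"
  have deg: "degree p = d"
    unfolding p_def diff_conv_add_uminus using assms
    by (subst degree_add_eq_left) (auto simp: degree_monom_eq)
  then have "p \<noteq> 0" using assms by auto
  moreover have "{x. x ^ d = c} = {x. poly p x = 0}"
    by (auto simp: p_def poly_monom)
  ultimately show ?thesis
    using card_poly_roots_bound[of p] deg by auto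
qed

text \<open>Substituting \<open>c * x\<close> for \<open>x\<close> multiplies the sum by
  \<open>c ^ m\<close>, so it suffices to find a nonzero \<open>c\<close> with
  \<open>c ^ m \<noteq> 1\<close>. Such a \<open>c\<close> exists because \<open>x ^ s = 1\<close>
  has at most \<open>s\<close> solutions and \<open>s\<close> is less than the number of nonzero
  elements.\<close>

lemma sum_powers_nonzero_eq_0:
  assumes "\<not> (CARD('a::{field,finite}) - 1) dvd m"
  shows "(\<Sum>x\<in>-{0::'a}. x ^ m) = 0"
proof -
  let ?N = "CARD('a) - 1"
  define s where "s = m mod ?N"
  have N: "?N > 0"
    using finite_UNIV_card_ge_0[where 'a='a] card_mono[of UNIV "{0, 1 :: 'a}"] by simp
  have s: "0 < s" "s < ?N" using assms N by (auto simp: s_def dvd_eq_mod_eq_0)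
  have pow: "x ^ m = x ^ s" if "x \<noteq> 0" for x :: 'a
  proof -
    have "x ^ m = x ^ (?N * (m div ?N) + m mod ?N)"
      by simp
    also have "\<dots> = (x ^ ?N) ^ (m div ?N) * x ^ s"
      by (simp only: power_add power_mult s_def)
    finally show ?thesis using field_power_card_minus_one[OF that] by simp
  qed
  obtain c :: 'a where c: "c \<noteq> 0" "c ^ s \<noteq> 1"
  proof (rule ccontr)
    assume "\<not> thesis"
    with that have "-{0::'a} \<subseteq> {x. x ^ s = 1}" by auto
    then have "card (-{0::'a}) \<le> card {x::'a. x ^ s = 1}" by (intro card_mono) auto
    also have "\<dots> \<le> s" using s by (intro card_power_eq_le)
    finally show False using s by (simp add: Compl_eq_Diff_UNIV card_Diff_singleton)
  qed
  have "(\<Sum>x\<in>-{0::'a}. x ^ m) = (\<Sum>x\<in>-{0::'a}. (c * x) ^ m)"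
    by (rule sum.reindex_bij_witness[of _ "\<lambda>y. c * y" "\<lambda>y. y / c"]) (use c in auto)
  also have "\<dots> = c ^ m * (\<Sum>x\<in>-{0::'a}. x ^ m)"
    by (simp add: power_mult_distrib sum_distrib_left)
  finally have "(1 - c ^ m) * (\<Sum>x\<in>-{0::'a}. x ^ m) = 0"
    by (simp add: algebra_simps)
  then show ?thesis using c pow[of c] by simp
qed

text \<open>Counting replaces a primitive root: fibres of the \<open>d\<close>-th power map have at
  most \<open>d\<close> elements, so its image has at least \<open>e\<close>, and it lies among the
  at most \<open>e\<close> roots of \<open>y ^ e = 1\<close>.\<close>

lemma image_power_eq_roots:
  assumes "CARD('a::{field,finite}) - 1 = d * e" "d * e > 0"
  shows "(\<lambda>x::'a. x ^ d) ` (-{0}) = {y. y ^ e = 1}" and "card {y::'a. y ^ e = 1} = e"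
proof -
  let ?R = "{y::'a. y ^ e = 1}" and ?I = "(\<lambda>x::'a. x ^ d) ` (-{0})"
  have sub: "?I \<subseteq> ?R"
    using field_power_card_minus_one[where 'a='a] unfolding assms(1) by (auto simp flip: power_mult)
  have R: "card ?R \<le> e" using assms by (intro card_power_eq_le) auto
  have "d * e = card (-{0::'a})"
    using assms by (simp add: Compl_eq_Diff_UNIV card_Diff_singleton)
  also have "\<dots> \<le> card (\<Union>y\<in>?I. {x. x ^ d = y})"
    by (intro card_mono) auto
  also have "\<dots> \<le> (\<Sum>y\<in>?I. card {x. x ^ d = y})"
    by (rule card_UN_le) simp
  also have "\<dots> \<le> (\<Sum>y\<in>?I. d)"
    using assms by (intro sum_mono card_power_eq_le) auto
  finally have "e \<le> card ?I" using assms by simp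
  then show "?I = ?R" "card ?R = e"
    using card_seteq[of ?R ?I] sub R card_mono[of ?R ?I] by auto
qed

text \<open>\<open>q\<close> is a power of the characteristic, since the latter divides
  \<open>CARD('a)\<close>, a power of the prime underlying \<open>q\<close>.\<close>

lemma frobenius_sum:
  fixes f :: "'b \<Rightarrow> 'a::{field,finite}"
  assumes "primepow q" "CARD('a) = q\<^sup>2"
  shows "sum f A ^ q = (\<Sum>i\<in>A. f i ^ q)"
proof -
  from assms(1) obtain p e where q: "prime p" "e > 0" "q = p ^ e"
    by (auto simp: primepow_def)
  have pr: "prime CHAR('a)"
    by (intro prime_CHAR_semidom finite_imp_CHAR_pos) auto
  have "CHAR('a) dvd p ^ (e * 2)"
    using CHAR_dvd_CARD[where 'a='a] assms(2) q by (simp add: power_mult)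
  then have "CHAR('a) = p"
    using pr q(1) prime_dvd_power primes_dvd_imp_eq by blast
  then show ?thesis
    using freshmans_dream_sum'[OF pr, of q e f A] q by simp
qed

lemma frobenius_add:
  fixes x y :: "'a::{field,finite}"
  assumes "primepow q" "CARD('a) = q\<^sup>2"
  shows "(x + y) ^ q = x ^ q + y ^ q"
  using frobenius_sum[OF assms, of "\<lambda>b. if b then x else y" UNIV] by (simp add: UNIV_bool add.commute)

section \<open>Hermitian hulls and scaled codes\<close>

definition hermitian_form :: "nat \<Rightarrow> 'a::field ^ 'n::finite \<Rightarrow> 'a ^ 'n \<Rightarrow> 'a" where
  "hermitian_form q y x = (\<Sum>i\<in>UNIV. y $ i * (x $ i) ^ q)"

section \<open>Rescaling the coordinates of a code\<close>

definition scale_coords :: "('n \<Rightarrow> 'a) \<Rightarrow> 'a::field ^ 'n::finite \<Rightarrow> 'a ^ 'n" where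
  "scale_coords d x = (\<chi> i. d i * x $ i)"

lemma scale_coords_nth [simp]: "scale_coords d x $ i = d i * x $ i"
  by (simp add: scale_coords_def)

lemma linear_scale_coords: "Vector_Spaces.linear (*s) (*s) (scale_coords d)"
  by unfold_locales (simp_all add: vec_eq_iff algebra_simps)

lemma inj_scale_coords:
  assumes "\<And>i. d i \<noteq> 0"
  shows "inj (scale_coords d)"
  by (rule injI) (use assms in \<open>simp add: vec_eq_iff\<close>)

lemma hamming_distance_scale_coords:
  assumes "\<And>i. d i \<noteq> 0"
  shows "hamming_distance (scale_coords d x) (scale_coords d y) = hamming_distance x y"
  using assms by (simp add: hamming_distance_def)

lemma MDS_code_scale_coords:
  assumes d: "\<And>i. d i \<noteq> 0" and C: "MDS_code n k C"
  shows "MDS_code n k (scale_coords d ` C)"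
proof -
  interpret lin: Vector_Spaces.linear "(*s)" "(*s)" "scale_coords d" by (rule linear_scale_coords)
  have "vec.subspace (scale_coords d ` C)"
    using C by (intro lin.subspace_image) (simp add: MDS_code_def linear_code_def)
  moreover have "vec.dim (scale_coords d ` C) = vec.dim C"
    by (intro vec.dim_image_eq linear_scale_coords inj_on_subset[OF inj_scale_coords] d) auto
  moreover have "minimum_distance (scale_coords d ` C) = minimum_distance C"
  proof -
    have "{hamming_distance x y |x y. x \<in> scale_coords d ` C \<and> y \<in> scale_coords d ` C \<and> x \<noteq> y}
        = {hamming_distance x y |x y. x \<in> C \<and> y \<in> C \<and> x \<noteq> y}" (is "?L = ?R")
    proof (intro equalityI subsetI)
      fix m assume "m \<in> ?L"
      then show "m \<in> ?R"
        using hamming_distance_scale_coords[of d] d by auto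
    next
      fix m assume "m \<in> ?R"
      then obtain x y where "m = hamming_distance x y" "x \<in> C" "y \<in> C" "x \<noteq> y" by blast
      then have "m = hamming_distance (scale_coords d x) (scale_coords d y)"
        "scale_coords d x \<noteq> scale_coords d y"
        using hamming_distance_scale_coords[of d] inj_scale_coords[of d] d by (auto simp: inj_eq)
      then show "m \<in> ?L" using \<open>x \<in> C\<close> \<open>y \<in> C\<close> by blast
    qed
    then show ?thesis by (simp add: minimum_distance_def)
  qed
  ultimately show ?thesis
    using C by (simp add: MDS_code_def linear_code_def)
qed

lemma hermitian_dual_iff: "x \<in> hermitian_dual q C \<longleftrightarrow> (\<forall>y\<in>C. hermitian_form q y x = 0)"
  by (simp add: hermitian_dual_def hermitian_form_def)

text \<open>Conjugation is an involution because \<open>x ^ (q\<^sup>2) = x\<close>; hence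
  orthogonality is symmetric.\<close>

lemma hermitian_form_swap:
  fixes x y :: "'a::{field,finite} ^ 'n::finite"
  assumes "primepow q" "CARD('a) = q\<^sup>2"
  shows "hermitian_form q x y = hermitian_form q y x ^ q"
  unfolding hermitian_form_def frobenius_sum[OF assms] power_mult_distrib
  using field_power_card[where 'a='a]
  by (simp add: assms(2) power2_eq_square mult.commute flip: power_mult)

lemma subspace_hermitian_dual:
  fixes C :: "('a::{field,finite} ^ 'n::finite) set"
  assumes "primepow q" "CARD('a) = q\<^sup>2"
  shows "vec.subspace (hermitian_dual q C)"
proof -
  have "q > 0" using primepow_gt_Suc_0[OF assms(1)] by simp
  then show ?thesis
    by (auto simp: vec.subspace_def hermitian_dual_def frobenius_add[OF assms] distrib_left
        sum.distrib power_mult_distrib mult.left_commute[of _ "_ ^ q"] power_0_left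
        simp flip: sum_distrib_left)
qed

lemma subspace_hermitian_hull:
  fixes C :: "('a::{field,finite} ^ 'n::finite) set"
  assumes "primepow q" "CARD('a) = q\<^sup>2" "vec.subspace C"
  shows "vec.subspace (hermitian_hull q C)"
  unfolding hermitian_hull_def by (intro vec.subspace_inter subspace_hermitian_dual assms)

text \<open>Linearity of the form in its first argument lets orthogonality be tested on generators,
  later the monomials.\<close>

lemma hermitian_dual_span: "hermitian_dual q (vec.span B) = hermitian_dual q B"
proof
  show "hermitian_dual q (vec.span B) \<subseteq> hermitian_dual q B"
    by (intro subsetI) (metis hermitian_dual_iff vec.span_base)
  show "hermitian_dual q B \<subseteq> hermitian_dual q (vec.span B)"
  proof
    fix x assume x: "x \<in> hermitian_dual q B"
    have "vec.subspace {y. hermitian_form q y x = 0}"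
      by (auto simp: vec.subspace_def hermitian_form_def distrib_right sum.distrib mult.assoc
          simp flip: sum_distrib_left)
    then have "vec.span B \<subseteq> {y. hermitian_form q y x = 0}"
      using x by (intro vec.span_minimal) (auto simp: hermitian_dual_iff)
    then show "x \<in> hermitian_dual q (vec.span B)"
      by (auto simp: hermitian_dual_iff)
  qed
qed

text \<open>Scaling one coordinate perturbs the Hermitian form by a multiple of
  \<open>y\<^sub>i x\<^sub>i\<^sup>q\<close>; testing it against a hull vector that is nonzero at \<open>i\<close> isolates this
  perturbation.\<close>

lemma hermitian_hull_scale_coord:
  fixes C :: "('a::{field,finite} ^ 'n::finite) set"
  assumes q: "primepow q" "CARD('a) = q\<^sup>2"
    and z: "z \<in> hermitian_hull q C" "z $ i \<noteq> 0"
    and \<alpha>: "\<alpha> \<noteq> 0" "\<alpha> ^ (q + 1) \<noteq> 1"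
  defines "d \<equiv> (\<lambda>j. if j = i then \<alpha> else 1)"
  shows "hermitian_hull q (scale_coords d ` C) = {x \<in> hermitian_hull q C. x $ i = 0}"
proof -
  have form: "hermitian_form q (scale_coords d y) (scale_coords d x) =
      hermitian_form q y x + (\<alpha> ^ (q + 1) - 1) * (y $ i * (x $ i) ^ q)" for x y
  proof -
    have "hermitian_form q (scale_coords d y) (scale_coords d x) =
        (\<Sum>j\<in>UNIV. y $ j * (x $ j) ^ q + (if j = i then (\<alpha> ^ (q + 1) - 1) * (y $ j * (x $ j) ^ q) else 0))"
      unfolding hermitian_form_def
      by (intro sum.cong) (auto simp: d_def algebra_simps power_mult_distrib)
    then show ?thesis by (simp add: sum.distrib hermitian_form_def)
  qed
  have unchanged: "scale_coords d x = x" if "x $ i = 0" for x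
    using that by (simp add: vec_eq_iff d_def)
  \<comment> \<open>Membership in the dual makes \<open>hermitian_form q x z\<close> vanish; the
    swap allows \<open>z\<close> as a test vector in the first argument.\<close>
  have zC: "z \<in> C" and zx: "hermitian_form q z x = 0" if "x \<in> C" for x
    using z that hermitian_form_swap[OF q, of z x] primepow_gt_Suc_0[OF q(1)]
    by (auto simp: hermitian_hull_def hermitian_dual_iff)
  show ?thesis
  proof (intro equalityI subsetI)
    fix u assume "u \<in> hermitian_hull q (scale_coords d ` C)"
    then obtain x where x: "u = scale_coords d x" "x \<in> C"
      and orth: "\<And>y. y \<in> C \<Longrightarrow> hermitian_form q (scale_coords d y) (scale_coords d x) = 0"
      by (auto simp: hermitian_hull_def hermitian_dual_iff)
    have "x $ i = 0"
      using orth[OF zC[OF x(2)]] zx[OF x(2)] \<alpha> z by (simp add: form)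
    moreover from this have "hermitian_form q y x = 0" if "y \<in> C" for y
      using orth[OF that] primepow_gt_Suc_0[OF q(1)] by (simp add: form power_0_left)
    ultimately show "u \<in> {x \<in> hermitian_hull q C. x $ i = 0}"
      using x unchanged by (simp add: hermitian_hull_def hermitian_dual_iff)
  next
    fix x assume "x \<in> {x \<in> hermitian_hull q C. x $ i = 0}"
    then have x: "x \<in> C" "x $ i = 0" "\<And>y. y \<in> C \<Longrightarrow> hermitian_form q y x = 0"
      by (auto simp: hermitian_hull_def hermitian_dual_iff)
    have "hermitian_form q (scale_coords d y) x = 0" if "y \<in> C" for y
      using form[of y x] x that primepow_gt_Suc_0[OF q(1)] by (simp add: unchanged power_0_left)
    moreover have "x \<in> scale_coords d ` C"
      using unchanged[OF x(2)] x(1) by (metis image_eqI)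
    ultimately show "x \<in> hermitian_hull q (scale_coords d ` C)"
      by (auto simp: hermitian_hull_def hermitian_dual_iff)
  qed
qed

section \<open>Lowering the dimension of the hull\<close>

lemma dim_zero_coord:
  fixes H :: "('a::field ^ 'n::finite) set"
  assumes H: "vec.subspace H" and z: "z \<in> H" "z $ i \<noteq> 0"
  shows "vec.dim H = Suc (vec.dim {x \<in> H. x $ i = 0})"
proof -
  let ?H0 = "{x \<in> H. x $ i = 0}"
  have H0: "vec.subspace ?H0"
    using H by (auto simp: vec.subspace_def)
  then have span0: "vec.span ?H0 = ?H0" by simp
  have "vec.span (insert z ?H0) = H"
  proof
    show "vec.span (insert z ?H0) \<subseteq> H"
      using z H by (intro vec.span_minimal) auto
    show "H \<subseteq> vec.span (insert z ?H0)"
    proof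
      fix x assume "x \<in> H"
      \<comment> \<open>Subtracting this multiple of \<open>z\<close> clears coordinate
        \<open>i\<close>.\<close>
      then have "x - (x $ i / z $ i) *s z \<in> ?H0"
        using z H by (auto intro!: vec.subspace_diff vec.subspace_scale)
      then show "x \<in> vec.span (insert z ?H0)"
        unfolding vec.span_insert span0 by blast
    qed
  qed
  then have "vec.dim H = vec.dim (insert z ?H0)" by (metis vec.dim_span)
  then show ?thesis using z by (simp add: vec.dim_insert span0 del: vec.span_eq_iff)
qed

lemma MDS_code_reduce_hull:
  fixes C :: "('a::{field,finite} ^ 'n::finite) set"
  assumes q: "primepow q" "q > 2" "CARD('a) = q\<^sup>2"
    and C: "MDS_code n k C" and s: "s \<le> vec.dim (hermitian_hull q C)"
  shows "\<exists>C' :: ('a ^ 'n) set. MDS_code n k C' \<and> vec.dim (hermitian_hull q C') = s"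
  using s
proof (induction rule: inc_induct)
  case base
  then show ?case using C by blast
next
  case (step s)
  then obtain D :: "('a ^ 'n) set" where D: "MDS_code n k D" "vec.dim (hermitian_hull q D) = Suc s"
    by blast
  have sub: "vec.subspace (hermitian_hull q D)"
    using D(1) by (intro subspace_hermitian_hull q) (simp add: MDS_code_def linear_code_def)
  obtain z i where z: "z \<in> hermitian_hull q D" "z $ i \<noteq> 0"
  proof -
    have "\<not> hermitian_hull q D \<subseteq> {0}"
      using D(2) vec.dim_eq_0[of "hermitian_hull q D"] by (metis nat.distinct(1))
    then obtain z where "z \<in> hermitian_hull q D" "z \<noteq> 0" by blast
    then show ?thesis using that by (auto simp: vec_eq_iff)
  qed
  \<comment> \<open>At most \<open>q + 1\<close> elements have norm 1, fewer than the
    \<open>q\<^sup>2 - 1\<close> nonzero ones because \<open>q > 2\<close>.\<close>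
  obtain \<alpha> :: 'a where \<alpha>: "\<alpha> \<noteq> 0" "\<alpha> ^ (q + 1) \<noteq> 1"
  proof (rule ccontr)
    assume "\<not> thesis"
    with that have "-{0::'a} \<subseteq> {x. x ^ (q + 1) = 1}" by blast
    then have "card (-{0::'a}) \<le> card {x::'a. x ^ (q + 1) = 1}" by (intro card_mono) auto
    also have "\<dots> \<le> q + 1" by (intro card_power_eq_le) auto
    finally have "q\<^sup>2 \<le> q + 2" using q(3) by (simp add: Compl_eq_Diff_UNIV card_Diff_singleton)
    moreover have "3 * q \<le> q\<^sup>2" using q(2) by (simp add: power2_eq_square)
    ultimately show False using q(2) by linarith
  qed
  let ?d = "\<lambda>j. if j = i then \<alpha> else 1"
  have "MDS_code n k (scale_coords ?d ` D)"
    using \<alpha> D by (intro MDS_code_scale_coords) auto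
  moreover have "vec.dim (hermitian_hull q (scale_coords ?d ` D)) = s"
    using dim_zero_coord[OF sub z] D(2) hermitian_hull_scale_coord[OF q(1,3) z \<alpha>] by simp
  ultimately show ?case by blast
qed

section \<open>Generalized Reed-Solomon codes\<close>

text \<open>\<open>e\<close> lists the evaluation points and \<open>v\<close> the column
  multipliers.\<close>

definition monomial_word :: "('n \<Rightarrow> 'a) \<Rightarrow> ('n \<Rightarrow> 'a) \<Rightarrow> nat \<Rightarrow> 'a::field ^ 'n::finite" where
  "monomial_word v e j = (\<chi> i. v i * e i ^ j)"

text \<open>A span of monomials rather than a set of polynomial values, because dimension and
  orthogonality are both settled on monomials.\<close>

definition GRS_code :: "('n \<Rightarrow> 'a) \<Rightarrow> ('n \<Rightarrow> 'a) \<Rightarrow> nat \<Rightarrow> ('a::field ^ 'n::finite) set" where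
  "GRS_code v e k = vec.span (monomial_word v e ` {..<k})"

lemma poly_word_in_GRS_code:
  assumes "degree p < k"
  shows "(\<chi> i. v i * poly p (e i)) \<in> GRS_code v e k"
proof -
  have "(\<chi> i. v i * poly p (e i)) = (\<Sum>j\<le>degree p. Polynomial.coeff p j *s monomial_word v e j)"
    by (simp add: vec_eq_iff monomial_word_def poly_altdef sum_distrib_left algebra_simps)
  also have "\<dots> \<in> GRS_code v e k"
    unfolding GRS_code_def using assms by (intro vec.span_sum vec.span_scale vec.span_base) auto
  finally show ?thesis .
qed

text \<open>This form serves the counting of roots. For \<open>k = 0\<close> the right side would be
  empty, as the zero polynomial has degree 0.\<close>

lemma GRS_code_eq:
  assumes "k > 0"
  shows "GRS_code v e k = {\<chi> i. v i * poly p (e i) |p. degree p < k}" (is "_ = ?E")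
proof
  have "vec.subspace ?E"
    unfolding vec.subspace_def
  proof safe
    show "\<exists>p. 0 = (\<chi> i. v i * poly p (e i)) \<and> degree p < k"
      using assms by (intro exI[of _ 0]) (simp add: vec_eq_iff)
    fix p q :: "'a poly" assume "degree p < k" "degree q < k"
    then show "\<exists>r. (\<chi> i. v i * poly p (e i)) + (\<chi> i. v i * poly q (e i)) =
        (\<chi> i. v i * poly r (e i)) \<and> degree r < k"
      by (intro exI[of _ "p + q"]) (simp add: vec_eq_iff degree_add_less algebra_simps)
  next
    fix c and p :: "'a poly" assume "degree p < k"
    then show "\<exists>r. c *s (\<chi> i. v i * poly p (e i)) = (\<chi> i. v i * poly r (e i)) \<and> degree r < k"
      by (intro exI[of _ "Polynomial.smult c p"])
        (auto simp: vec_eq_iff algebra_simps intro: le_less_trans[OF degree_smult_le])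
  qed
  moreover have "monomial_word v e ` {..<k} \<subseteq> ?E"
  proof safe
    fix j assume "j < k"
    then show "\<exists>p. monomial_word v e j = (\<chi> i. v i * poly p (e i)) \<and> degree p < k"
      by (intro exI[of _ "Polynomial.monom 1 j"])
        (simp add: monomial_word_def poly_monom degree_monom_eq)
  qed
  ultimately show "GRS_code v e k \<subseteq> ?E"
    unfolding GRS_code_def by (intro vec.span_minimal)
  show "?E \<subseteq> GRS_code v e k"
    using poly_word_in_GRS_code by blast
qed

lemma card_poly_roots_at_inj_le:
  fixes e :: "'n::finite \<Rightarrow> 'a::field"
  assumes "inj e" "p \<noteq> 0"
  shows "card {i. poly p (e i) = 0} \<le> degree p"
proof -
  have "card {i. poly p (e i) = 0} = card (e ` {i. poly p (e i) = 0})"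
    using assms(1) by (metis card_image inj_on_subset subset_UNIV)
  also have "\<dots> \<le> card {x. poly p x = 0}"
    using assms by (intro card_mono poly_roots_finite) auto
  also have "\<dots> \<le> degree p" by (intro card_poly_roots_bound assms)
  finally show ?thesis .
qed

text \<open>If the word of \<open>x ^ m\<close> depended on the lower ones, a monic polynomial of
  degree \<open>m < CARD('n)\<close> would vanish at all \<open>CARD('n)\<close> evaluation
  points.\<close>

lemma monomial_words_independent:
  fixes v e :: "'n::finite \<Rightarrow> 'a::field"
  assumes "inj e" "\<And>i. v i \<noteq> 0" "k \<le> CARD('n)"
  shows "vec.independent (monomial_word v e ` {..<k})" "inj_on (monomial_word v e) {..<k}"
proof -
  have new: "monomial_word v e m \<notin> vec.span (monomial_word v e ` {..<m})" if "m < k" for m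
  proof
    assume *: "monomial_word v e m \<in> vec.span (monomial_word v e ` {..<m})"
    \<comment> \<open>The alternative \<open>p = 0\<close> is for \<open>m = 0\<close>, where
      \<open>degree p < m\<close> cannot hold.\<close>
    have "\<exists>p. monomial_word v e m = (\<chi> i. v i * poly p (e i)) \<and> (p = 0 \<or> degree p < m)"
    proof (cases "m = 0")
      case True
      with * have "monomial_word v e m = 0" by simp
      then show ?thesis by (intro exI[of _ 0]) (simp add: vec_eq_iff)
    next
      case False
      then have "monomial_word v e m \<in> {\<chi> i. v i * poly p (e i) |p. degree p < m}"
        using * by (subst GRS_code_eq[symmetric]) (simp_all add: GRS_code_def)
      then show ?thesis by blast
    qed
    then obtain p where p: "monomial_word v e m = (\<chi> i. v i * poly p (e i))" "p = 0 \<or> degree p < m"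
      by blast
    let ?q = "Polynomial.monom 1 m - p"
    have "Polynomial.coeff p m = 0" using p(2) by (auto simp: coeff_eq_0)
    then have deg: "Polynomial.coeff ?q m = 1" by simp
    have "degree p \<le> m" using p(2) by auto
    then have deg': "degree ?q \<le> m" by (intro degree_diff_le) (simp_all add: degree_monom_le)
    have "?q \<noteq> 0"
    proof
      assume "?q = 0"
      with deg show False by (simp only: coeff_0) simp
    qed
    then have "card {i. poly ?q (e i) = 0} \<le> m"
      using card_poly_roots_at_inj_le[OF assms(1), of ?q] deg' by linarith
    moreover have "{i. poly ?q (e i) = 0} = UNIV"
    proof -
      have "v i * e i ^ m = v i * poly p (e i)" for i
        using p(1) unfolding vec_eq_iff monomial_word_def by simp
      then show ?thesis using assms(2) by (simp add: poly_monom)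
    qed
    ultimately have "CARD('n) \<le> m" by metis
    with that assms(3) show False by linarith
  qed
  show "vec.independent (monomial_word v e ` {..<k})"
    using new
  proof (induction k)
    case (Suc k)
    have "vec.independent (monomial_word v e ` {..<k})"
      by (rule Suc.IH) (rule Suc.prems, simp)
    with Suc.prems[of k] show ?case
      unfolding lessThan_Suc image_insert by (intro vec.independent_insertI) simp_all
  qed (simp add: vec.independent_empty)
  show "inj_on (monomial_word v e) {..<k}"
  proof (rule linorder_inj_onI)
    fix i j assume "i < j" "i \<in> {..<k}" "j \<in> {..<k}"
    moreover from this have "monomial_word v e i \<in> vec.span (monomial_word v e ` {..<j})"
      by (intro vec.span_base) simp
    ultimately show "monomial_word v e i \<noteq> monomial_word v e j"
      using new[of j] by (metis lessThan_iff)
  qed auto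
qed

text \<open>Two words agree exactly at the roots of \<open>p - r\<close> among the evaluation
  points, and there are at most \<open>k - 1\<close> of these.\<close>

lemma MDS_code_GRS_code:
  fixes v e :: "'n::finite \<Rightarrow> 'a::field"
  assumes e: "inj e" and v: "\<And>i. v i \<noteq> 0" and k: "0 < k" "k \<le> CARD('n)"
  shows "MDS_code (CARD('n)) k (GRS_code v e k)"
proof -
  let ?C = "GRS_code v e k"
  let ?w = "\<lambda>p. \<chi> i. v i * poly p (e i)"
  note words = monomial_words_independent[OF e v k(2)]
  have dim: "vec.dim ?C = k"
    unfolding GRS_code_def
    using vec.dim_span_eq_card_independent[OF words(1)] card_image[OF words(2)] by simp
  have dist: "hamming_distance (?w p) (?w r) = CARD('n) - card {i. poly (p - r) (e i) = 0}" for p r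
  proof -
    have "{i. ?w p $ i \<noteq> ?w r $ i} = - {i. poly (p - r) (e i) = 0}"
      using v by auto
    then show ?thesis by (simp add: hamming_distance_def Compl_eq_Diff_UNIV card_Diff_subset)
  qed
  have "minimum_distance ?C = CARD('n) - k + 1"
    unfolding minimum_distance_def
  proof (rule Min_eqI)
    have "{hamming_distance x y |x y. x \<in> ?C \<and> y \<in> ?C \<and> x \<noteq> y} \<subseteq> {..CARD('n)}"
      by (auto simp: hamming_distance_def intro: card_mono)
    then show "finite {hamming_distance x y |x y. x \<in> ?C \<and> y \<in> ?C \<and> x \<noteq> y}"
      by (rule finite_subset) simp
  next
    fix m assume "m \<in> {hamming_distance x y |x y. x \<in> ?C \<and> y \<in> ?C \<and> x \<noteq> y}"
    then obtain p r where m: "m = hamming_distance (?w p) (?w r)" "?w p \<noteq> ?w r"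
      and deg: "degree p < k" "degree r < k"
      unfolding GRS_code_eq[OF k(1)] by blast
    have "p - r \<noteq> 0" using m(2) by auto
    then have "card {i. poly (p - r) (e i) = 0} \<le> degree (p - r)"
      by (rule card_poly_roots_at_inj_le[OF e])
    also have "\<dots> < k" using deg by (rule degree_diff_less)
    finally show "CARD('n) - k + 1 \<le> m" unfolding m dist using k(2) by linarith
  next
    obtain A :: "'n set" where A: "card A = k - 1"
    proof -
      have "k - 1 \<le> card (UNIV :: 'n set)" using k by simp
      then show ?thesis using that by (rule obtain_subset_with_card_n)
    qed
    \<comment> \<open>The roots of \<open>p\<close> are \<open>k - 1\<close> evaluation points, so
      its word attains the minimum distance from the zero word.\<close>
    define p where "p = (\<Prod>i\<in>A. [:- e i, 1:])"
    have deg: "degree p < k"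
      unfolding p_def using degree_prod_sum_le[of A "\<lambda>i. [:- e i, 1:]"] A k(1) by simp
    have "{i. poly (p - 0) (e i) = 0} = A"
      using inj_eq[OF e] by (auto simp: p_def poly_prod)
    then have d: "hamming_distance (?w p) (?w 0) = CARD('n) - k + 1"
      using dist[of p 0] A k by simp
    have "?w p \<noteq> ?w 0"
    proof
      assume "?w p = ?w 0"
      then have "hamming_distance (?w p) (?w 0) = 0" by (simp only: hamming_distance_def) simp
      with d show False by linarith
    qed
    moreover have "?w p \<in> ?C" "?w 0 \<in> ?C"
      using deg k(1) by (intro poly_word_in_GRS_code; simp)+
    ultimately show "CARD('n) - k + 1 \<in> {hamming_distance x y |x y. x \<in> ?C \<and> y \<in> ?C \<and> x \<noteq> y}"
      using d[symmetric] by (intro CollectI exI[of _ "?w p"] exI[of _ "?w 0"] conjI)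
  qed
  then show ?thesis
    using dim by (simp add: MDS_code_def linear_code_def GRS_code_def)
qed

lemma dim_hermitian_hull_GRS_code_ge:
  fixes v e :: "'n::finite \<Rightarrow> 'a::field"
  assumes "inj e" "\<And>i. v i \<noteq> 0" "k \<le> CARD('n)"
    and J: "J \<subseteq> {..<k}"
    and orth: "\<And>i j. i < k \<Longrightarrow> j \<in> J \<Longrightarrow> hermitian_form q (monomial_word v e i) (monomial_word v e j) = 0"
  shows "card J \<le> vec.dim (hermitian_hull q (GRS_code v e k))"
proof -
  note words = monomial_words_independent[OF assms(1-3)]
  have "card J = card (monomial_word v e ` J)"
    using inj_on_subset[OF words(2) J] by (simp add: card_image)
  also have "\<dots> = vec.dim (monomial_word v e ` J)"
    using vec.independent_mono[OF words(1) image_mono[OF J]]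
    by (simp add: vec.dim_eq_card_independent)
  also have "\<dots> \<le> vec.dim (hermitian_hull q (GRS_code v e k))"
  proof (rule vec.dim_subset, rule subsetI)
    fix x assume "x \<in> monomial_word v e ` J"
    then obtain j where j: "x = monomial_word v e j" "j \<in> J" by blast
    then have "x \<in> hermitian_dual q (GRS_code v e k)"
      unfolding GRS_code_def hermitian_dual_span using orth by (simp add: hermitian_dual_iff)
    moreover have "x \<in> GRS_code v e k"
      unfolding GRS_code_def j(1) using j(2) J by (intro vec.span_base imageI) (rule subsetD)
    ultimately show "x \<in> hermitian_hull q (GRS_code v e k)"
      by (simp add: hermitian_hull_def)
  qed
  finally show ?thesis .
qed

section \<open>Pairs of nonorthogonal monomials\<close>

text \<open>Modulo \<open>q\<^sup>2 - 1\<close>, multiplication by \<open>q\<close> swaps the two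
  \<open>q\<close>-adic digits of \<open>j\<close>. The size bounds leave
  \<open>q\<^sup>2 - 1\<close> as the only possible multiple, and both its digits are
  \<open>q - 1\<close>.\<close>

lemma nonorthogonal_exponent_digits:
  fixes q r t i j :: int
  assumes "0 < q" "0 < r" "t + r \<le> q" "0 \<le> i" "i < t * q" "0 \<le> j" "j < t * q"
    and dvd: "q\<^sup>2 - 1 dvd i + q * j + r"
  shows "i div q + j mod q = q - 1" and "i mod q + j div q + r = q - 1"
proof -
  define a b c d where "a = i div q" "b = i mod q" "c = j div q" "d = j mod q"
  have i: "i = a * q + b" and j: "j = c * q + d"
    by (simp_all add: a_b_c_d_def)
  have bd: "0 \<le> b" "b < q" "0 \<le> d" "d < q"
    using assms by (simp_all add: a_b_c_d_def)
  have a0: "0 \<le> a" and c0: "0 \<le> c"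
    using assms by (simp_all add: a_b_c_d_def pos_imp_zdiv_nonneg_iff)
  have "a * q < t * q" "c * q < t * q"
    using assms(5,7) bd i j by linarith+
  then have at: "a < t" and ct: "c < t"
    using assms(1) by simp_all
  \<comment> \<open>\<open>V\<close> is the given sum with \<open>c * q\<^sup>2\<close> reduced to
    \<open>c\<close>.\<close>
  define V where "V = (a + d) * q + (b + c + r)"
  have "i + q * j + r = V + c * (q\<^sup>2 - 1)"
    by (simp add: V_def i j algebra_simps power2_eq_square)
  then have "q\<^sup>2 - 1 dvd V"
    using dvd by (metis dvd_add_times_triv_right_iff)
  moreover have "0 < V"
    unfolding V_def using a0 bd c0 assms by (intro add_nonneg_pos mult_nonneg_nonneg) auto
  moreover have "V < 2 * (q\<^sup>2 - 1)"
  proof -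
    \<comment> \<open>Here \<open>a \<le> t - 1\<close>, \<open>d \<le> q - 1\<close> and
      \<open>t \<le> q - r\<close>.\<close>
    have "(a + d) * q \<le> (2 * q - 2 - r) * q"
      using at bd assms by (intro mult_right_mono) auto
    moreover have "b + c + r \<le> 2 * q - 2"
      using ct bd assms by linarith
    ultimately have "V \<le> (2 * q - 2 - r) * q + (2 * q - 2)"
      by (simp add: V_def)
    also have "\<dots> = 2 * (q\<^sup>2 - 1) - r * q"
      by (simp add: algebra_simps power2_eq_square)
    finally show ?thesis using mult_pos_pos[OF assms(2,1)] by linarith
  qed
  moreover have "V = W" if W: "W dvd V" "0 < V" "V < 2 * W" for W
  proof -
    from W(1) obtain m where m: "V = W * m" by (auto elim: dvdE)
    have "0 < W" using W by linarith
    then have "0 < m" "m < 2" using W m by (auto simp: zero_less_mult_iff)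
    then show ?thesis using m by simp
  qed
  ultimately have "V = q\<^sup>2 - 1" by blast
  then have eq: "(a + d - (q - 1)) * q = q - 1 - (b + c + r)"
    by (simp add: V_def algebra_simps power2_eq_square)
  \<comment> \<open>\<open>b + c + r\<close> lies between 1 and \<open>2 * q - 2\<close>, so the
    multiple of \<open>q\<close> in \<open>eq\<close> has absolute value below \<open>q\<close> and
    is 0: there is no carry.\<close>
  have "\<bar>(a + d - (q - 1)) * q\<bar> < q"
    unfolding eq using ct c0 bd assms by (auto simp: abs_less_iff)
  then have "\<bar>a + d - (q - 1)\<bar> * q < 1 * q"
    using assms(1) by (simp add: abs_mult)
  then have "a + d - (q - 1) = 0"
    using assms(1) by (subst (asm) mult_less_cancel_right_pos) auto
  with eq show "i div q + j mod q = q - 1" and "i mod q + j div q + r = q - 1"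
    by (simp_all add: a_b_c_d_def)
qed

text \<open>Only one of the two divisibility conditions is recorded; the other one holds for the
  swapped pairs.\<close>

definition nonorthogonal_exponents :: "nat \<Rightarrow> nat \<Rightarrow> nat \<Rightarrow> (nat \<times> nat) set" where
  "nonorthogonal_exponents q r k =
     {(i, j). i < k \<and> j < k \<and> q\<^sup>2 - 1 dvd i + q * j + r}"

lemma finite_nonorthogonal_exponents: "finite (nonorthogonal_exponents q r k)"
  by (rule finite_subset[of _ "{..<k} \<times> {..<k}"]) (auto simp: nonorthogonal_exponents_def)

text \<open>The digit equations recover the low digits from the leading digits \<open>a\<close>,
  \<open>b\<close>, so the pairs embed into \<open>U\<close>. A leading digit \<open>t - 1\<close>
  forces the low digit below \<open>c\<close>; the low digits are \<open>q - 1 - r - b\<close> for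
  \<open>i\<close> and \<open>q - 1 - a\<close> for \<open>j\<close>, which gives the last two
  conditions.\<close>

lemma card_nonorthogonal_exponents_le:
  fixes t c :: int
  assumes "0 < q" "0 < r" "t + int r \<le> int q" "int k = (t - 1) * int q + c" "c \<le> int q"
    and "finite U"
    and U: "\<And>a b. \<lbrakk>0 \<le> a; a < t; 0 \<le> b; b < t; a = t - 1 \<Longrightarrow> int q - int r - c \<le> b;
               b = t - 1 \<Longrightarrow> int q - c \<le> a\<rbrakk> \<Longrightarrow> (a, b) \<in> U"
  shows "card (nonorthogonal_exponents q r k) \<le> card U"
proof (rule card_inj_on_le[where f = "\<lambda>(i, j). (int i div int q, int j div int q)"])
  let ?Q = "int q"
  have tq: "(t - 1) * ?Q = t * ?Q - ?Q" by (simp add: algebra_simps)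
  have digits: "int i div ?Q + int j mod ?Q = ?Q - 1" "int i mod ?Q + int j div ?Q + int r = ?Q - 1"
    if "(i, j) \<in> nonorthogonal_exponents q r k" for i j
  proof -
    have "q\<^sup>2 \<ge> 1" using assms(1) by simp
    moreover from that have "int (q\<^sup>2 - 1) dvd int (i + q * j + r)"
      unfolding nonorthogonal_exponents_def int_dvd_int_iff by blast
    ultimately have "?Q\<^sup>2 - 1 dvd int i + ?Q * int j + int r"
      by (simp add: of_nat_diff)
    moreover have "int i < t * ?Q" "int j < t * ?Q"
      using that assms(4,5) tq by (auto simp: nonorthogonal_exponents_def)
    ultimately show "int i div ?Q + int j mod ?Q = ?Q - 1"
      "int i mod ?Q + int j div ?Q + int r = ?Q - 1"
      using nonorthogonal_exponent_digits[of ?Q "int r" t "int i" "int j"] assms(1-3) by auto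
  qed
  show "inj_on (\<lambda>(i, j). (int i div ?Q, int j div ?Q)) (nonorthogonal_exponents q r k)"
  proof (rule inj_onI, clarify)
    fix i j i' j'
    assume P: "(i, j) \<in> nonorthogonal_exponents q r k" "(i', j') \<in> nonorthogonal_exponents q r k"
      and div: "int i div ?Q = int i' div ?Q" "int j div ?Q = int j' div ?Q"
    from digits[OF P(1)] digits[OF P(2)] div
    have "int i mod ?Q = int i' mod ?Q" "int j mod ?Q = int j' mod ?Q" by linarith+
    with div show "i = i' \<and> j = j'"
      by (metis div_mult_mod_eq of_nat_eq_iff)
  qed
  show "(\<lambda>(i, j). (int i div ?Q, int j div ?Q)) ` nonorthogonal_exponents q r k \<subseteq> U"
  proof clarify
    fix i j assume P: "(i, j) \<in> nonorthogonal_exponents q r k"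
    define a b where "a = int i div ?Q" and "b = int j div ?Q"
    have i: "int i = a * ?Q + int i mod ?Q" and j: "int j = b * ?Q + int j mod ?Q"
      by (simp_all add: a_def b_def)
    have m: "0 \<le> int i mod ?Q" "int i mod ?Q < ?Q" "0 \<le> int j mod ?Q" "int j mod ?Q < ?Q"
      using assms(1) by simp_all
    have k: "int i < (t - 1) * ?Q + c" "int j < (t - 1) * ?Q + c"
      using P assms(4) by (auto simp: nonorthogonal_exponents_def)
    have "a * ?Q < t * ?Q" "b * ?Q < t * ?Q"
      using i j m k assms(5) tq by linarith+
    then have "a < t" "b < t" using assms(1) by simp_all
    moreover have "0 \<le> a" "0 \<le> b"
      using assms(1) by (simp_all add: a_def b_def pos_imp_zdiv_nonneg_iff)
    moreover have "?Q - int r - c \<le> b" if "a = t - 1"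
      using digits(2)[OF P] i k(1) unfolding that b_def[symmetric] by linarith
    moreover have "?Q - c \<le> a" if "b = t - 1"
      using digits(1)[OF P] j k(2) unfolding that a_def[symmetric] by linarith
    ultimately show "(int i div ?Q, int j div ?Q) \<in> U"
      unfolding a_def[symmetric] b_def[symmetric] by (intro U) auto
  qed
qed fact

section \<open>Counting leading digits in the four parameter ranges\<close>

lemma card_int_rectangle: "0 \<le> a \<Longrightarrow> 0 \<le> b \<Longrightarrow> int (card ({0..<a::int} \<times> {0..<b::int})) = a * b"
  by (simp add: card_cartesian_product)

text \<open>Each \<open>b < t - 1\<close> admits at most \<open>t\<close> values of
  \<open>a\<close>, and \<open>b = t - 1\<close> only those from \<open>q - c\<close> on. This
  serves the last range of \<open>k\<close> and, with \<open>t - 1\<close> for \<open>t\<close>, the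
  low end of the second.\<close>

lemma card_nonorthogonal_exponents_last_rows:
  fixes t c :: int
  assumes "0 < q" "0 < r" "t + int r \<le> int q" "1 \<le> t"
    and "int k = (t - 1) * int q + c" "int q - t + 1 \<le> c" "c \<le> int q"
  shows "int (card (nonorthogonal_exponents q r k)) \<le> t\<^sup>2 - (int q - c)"
proof -
  let ?U = "{0..<t} \<times> {0..<t - 1} \<union> {int q - c..<t} \<times> {t - 1}"
  have "card (nonorthogonal_exponents q r k) \<le> card ?U"
    using assms by (intro card_nonorthogonal_exponents_le[where t = t and c = c]) auto
  also have "card ?U \<le> card ({0..<t} \<times> {0..<t - 1}) + card ({int q - c..<t} \<times> {t - 1})"
    by (rule card_Un_le)
  finally have "int (card (nonorthogonal_exponents q r k))
      \<le> int (card ({0..<t} \<times> {0..<t - 1})) + int (card ({int q - c..<t} \<times> {t - 1}))"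
    by linarith
  also have "\<dots> = t * (t - 1) + (t - (int q - c))"
    using assms by (subst card_int_rectangle) (auto simp: card_cartesian_product)
  also have "\<dots> = t\<^sup>2 - (int q - c)"
    by (simp add: algebra_simps power2_eq_square)
  finally show ?thesis .
qed

text \<open>With \<open>k = (t - 1) * q + c\<close> and \<open>q - a = r - 1\<close> the four ranges
  become intervals of \<open>c\<close>, and each \<open>l\<close> is \<open>k\<close> minus twice a
  bound for the number of admissible leading digits.\<close>

lemma hull_parameters_card_nonorthogonal_exponents:
  fixes q r k' :: nat and h a t k l :: int
  assumes "0 < q" "0 < r" "2 * int r \<le> int q + 1" "int r < int q" "1 \<le> t" "2 * t \<le> int q + 2 - int r"
    and k': "k = int k'"
    and a: "a = int q + 1 - int r"
    and div_h: "(h - 1) * (int q + 1) div h = a"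
    and hp: "hull_parameters (int q) h t k l"
  shows "l \<le> k - 2 * int (card (nonorthogonal_exponents q r k'))"
proof -
  let ?P = "nonorthogonal_exponents q r k'" and ?Q = "int q" and ?R = "int r"
  define c where "c = k - (t - 1) * ?Q"
  have k: "k = (t - 1) * ?Q + c" by (simp add: c_def)
  have kk: "int k' = (t - 1) * ?Q + c" using k' k by simp
  have tq: "t * ?Q = (t - 1) * ?Q + ?Q" by (simp add: algebra_simps)
  have tr: "t + ?R \<le> ?Q" using assms by linarith
  consider (1) "1 \<le> c" "c \<le> ?R - t" "l = k - 2 * (t - 1)\<^sup>2"
    | (2) "?R - t + 1 \<le> c" "c \<le> ?R - 1" "l = 2 * t * ?Q + 2 * t - 2 * t\<^sup>2 - k - 2 * a"
    | (3) "?R \<le> c" "c \<le> ?Q - t" "l = k + 2 * t - 2 * t\<^sup>2"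
    | (4) "?Q - t + 1 \<le> c" "c \<le> ?Q" "l = 2 * t * ?Q - 2 * t\<^sup>2 - k"
    using hp unfolding hull_parameters_def div_h Let_def tq k a
    by (elim disjE) (auto simp: algebra_simps)
  then show ?thesis
  proof cases
    case 1
    \<comment> \<open>The digit \<open>b = t - 1\<close> would need
      \<open>a \<ge> q - c \<ge> t\<close>. The digit \<open>a = t - 1\<close> would need
      \<open>b \<ge> q - r - c \<ge> t - 1\<close>, by \<open>2 * r \<le> q + 1\<close>, hence again
      \<open>b = t - 1\<close>.\<close>
    have "card ?P \<le> card ({0..<t - 1} \<times> {0..<t - 1})"
      using assms 1 by (intro card_nonorthogonal_exponents_le[OF _ _ tr kk]) force+
    then have "int (card ?P) \<le> (t - 1) * (t - 1)"
      using card_int_rectangle[of "t - 1" "t - 1"] assms(5) by linarith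
    then show ?thesis using 1 by (simp add: power2_eq_square)
  next
    case 2
    show ?thesis
    proof (cases "1 \<le> c")
      case True
      \<comment> \<open>\<open>b = t - 1\<close> stays impossible, as
        \<open>q - c > q - r \<ge> t\<close>; only \<open>a = t - 1\<close> adds pairs.\<close>
      let ?U = "{0..<t - 1} \<times> {0..<t - 1} \<union> {t - 1} \<times> {?Q - ?R - c..<t - 1}"
      have "card ?P \<le> card ?U"
        using assms 2 by (intro card_nonorthogonal_exponents_le[OF _ _ tr kk]) force+
      also have "card ?U \<le> card ({0..<t - 1} \<times> {0..<t - 1}) + card ({t - 1} \<times> {?Q - ?R - c..<t - 1})"
        by (rule card_Un_le)
      finally have "int (card ?P) \<le> int (card ({0..<t - 1} \<times> {0..<t - 1})) + int (card ({t - 1} \<times> {?Q - ?R - c..<t - 1}))"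
        by linarith
      \<comment> \<open>The added part has \<open>t - 1 - (q - r - c)\<close> elements or none;
        \<open>2 * r \<le> q + 1\<close> and \<open>c \<ge> r - t + 1\<close> bound it by
        \<open>t + c - r\<close> either way.\<close>
      also have "\<dots> \<le> (t - 1) * (t - 1) + (t + c - ?R)"
        using assms 2 True by (subst card_int_rectangle) (auto simp: card_cartesian_product)
      finally show ?thesis using 2 unfolding k a by (simp add: algebra_simps power2_eq_square)
    next
      case False
      \<comment> \<open>Here \<open>k\<close> does not exceed \<open>(t - 1) q\<close>, so \<open>t - 1\<close> takes the role of \<open>t\<close>.\<close>
      have "int (card ?P) \<le> (t - 1)\<^sup>2 - (?Q - (c + ?Q))"
        using assms 2 False kk
        by (intro card_nonorthogonal_exponents_last_rows) (auto simp: algebra_simps)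
      \<comment> \<open>Here \<open>l = k - 2 * (t - 1)\<^sup>2 - 2 * (t + c - r)\<close>, and
        \<open>r - t + 1 \<le> c \<le> 0\<close> gives \<open>t > r\<close>.\<close>
      then show ?thesis using 2 False unfolding k a by (simp add: algebra_simps power2_eq_square)
    qed
  next
    case 3
    \<comment> \<open>\<open>b = t - 1\<close> would need
      \<open>a \<ge> q - c \<ge> t\<close>.\<close>
    have "card ?P \<le> card ({0..<t} \<times> {0..<t - 1})"
      using assms 3 by (intro card_nonorthogonal_exponents_le[OF _ _ tr kk]) force+
    then have "int (card ?P) \<le> t * (t - 1)"
      using card_int_rectangle[of t "t - 1"] assms(5) by linarith
    then show ?thesis using 3 by (simp add: algebra_simps power2_eq_square)
  next
    case 4
    have "int (card ?P) \<le> t\<^sup>2 - (?Q - c)"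
      using assms 4 tr kk by (intro card_nonorthogonal_exponents_last_rows) auto
    then show ?thesis using 4 unfolding k by (simp add: algebra_simps power2_eq_square)
  qed
qed

section \<open>Codes with large and with prescribed hull\<close>

lemma hermitian_form_monomial_words:
  fixes v e :: "'n::finite \<Rightarrow> 'a::{field,finite}"
  assumes card: "CARD('a) = q\<^sup>2"
    and e: "inj e" "range e = {x. x \<noteq> 0 \<and> x ^ m \<noteq> 1}"
    and v: "\<And>i. v i ^ (q + 1) = \<theta> * e i ^ r * (e i ^ m - 1)"
    and "\<not> q\<^sup>2 - 1 dvd i + q * j + r" "\<not> q\<^sup>2 - 1 dvd i + q * j + (r + m)"
  shows "hermitian_form q (monomial_word v e i) (monomial_word v e j) = 0"
proof -
  let ?g = "\<lambda>x. \<theta> * x ^ r * (x ^ m - 1) * x ^ (i + q * j)"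
  have "v l * e l ^ i * (v l * e l ^ j) ^ q = ?g (e l)" for l
  proof -
    have "v l * e l ^ i * (v l * e l ^ j) ^ q = v l ^ (q + 1) * e l ^ (i + q * j)"
      by (simp add: power_mult_distrib power_add mult_ac flip: power_mult)
    then show ?thesis by (simp only: v)
  qed
  then have "hermitian_form q (monomial_word v e i) (monomial_word v e j) = (\<Sum>l\<in>UNIV. ?g (e l))"
    by (simp add: hermitian_form_def monomial_word_def)
  also have "\<dots> = sum ?g (range e)"
    using e(1) by (simp add: sum.reindex)
  \<comment> \<open>The added points satisfy \<open>x ^ m = 1\<close> and contribute 0.\<close>
  also have "\<dots> = sum ?g (-{0})"
    unfolding e(2) by (rule sum.mono_neutral_left) auto
  also have "\<dots> = \<theta> * ((\<Sum>x\<in>-{0}. x ^ (i + q * j + (r + m))) - (\<Sum>x\<in>-{0}. x ^ (i + q * j + r)))"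
    by (simp add: sum_distrib_left sum_subtractf[symmetric] algebra_simps power_add)
  also have "\<dots> = 0"
    using assms by (simp add: sum_powers_nonzero_eq_0)
  finally show ?thesis .
qed

text \<open>A nonzero element is a norm \<open>u ^ (q + 1)\<close> exactly when its
  \<open>(q - 1)\<close>-st power is 1. For \<open>y = x ^ m = (x ^ r) ^ (q - 1)\<close> the
  conjugate \<open>y ^ q\<close> is the inverse of \<open>y\<close>, so
  \<open>y * (y - 1) ^ (q - 1) = -1\<close>; the factor \<open>\<theta>\<close> removes this
  sign.\<close>

lemma exists_GRS_multipliers:
  fixes q h r m :: nat
  assumes q: "primepow q" "CARD('a::{field,finite}) = q\<^sup>2"
    and h: "q + 1 = h * r" and m: "m = (q - 1) * r"
  obtains \<theta> :: "'a::{field,finite}" and v :: "'a::{field,finite} \<Rightarrow> 'a" where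
    "\<And>x. x \<noteq> 0 \<Longrightarrow> x ^ m \<noteq> 1 \<Longrightarrow> v x \<noteq> 0 \<and> v x ^ (q + 1) = \<theta> * x ^ r * (x ^ m - 1)"
proof -
  have q1: "q > 1" using primepow_gt_Suc_0[OF q(1)] by simp
  have "q\<^sup>2 - 1 = (q - 1) * (q + 1)"
    by (simp add: power2_eq_square algebra_simps)
  then have N: "CARD('a) - 1 = (q - 1) * (q + 1)" "(q - 1) * (q + 1) > 0"
    using q1 by (simp_all only: q(2)) simp
  have N': "CARD('a) - 1 = (q + 1) * (q - 1)" "(q + 1) * (q - 1) > 0"
    using N by (simp_all only: mult.commute)
  \<comment> \<open>Expanding a \<open>q\<close>-th power of 0 treats odd and even \<open>q\<close>
    alike.\<close>
  have "(1 + (-1)) ^ q = 1 + (-1 :: 'a) ^ q"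
    using frobenius_add[OF q, of 1 "-1"] by simp
  then have "(-1 :: 'a) ^ q = -1"
    using q1 by (simp add: power_0_left add_eq_0_iff)
  then have "(-1 :: 'a) ^ (q + 1) = 1" by simp
  then have "-1 \<in> (\<lambda>x::'a. x ^ (q - 1)) ` (-{0})"
    unfolding image_power_eq_roots(1)[OF N] by blast
  then obtain \<theta> :: 'a where \<theta>: "\<theta> \<noteq> 0" "\<theta> ^ (q - 1) = -1" by fastforce
  have "\<exists>u. u \<noteq> 0 \<and> u ^ (q + 1) = \<theta> * x ^ r * (x ^ m - 1)"
    if x: "x \<noteq> 0" "x ^ m \<noteq> 1" for x :: 'a
  proof -
    define y where "y = x ^ m"
    have "y * y ^ q = x ^ (m * (q + 1))"
      by (simp add: y_def power_add flip: power_mult)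
    also have "m * (q + 1) = (CARD('a) - 1) * r" unfolding N m by (simp only: mult_ac)
    also have "x ^ \<dots> = 1"
      by (simp only: power_mult field_power_card_minus_one[OF x(1)] power_one)
    finally have y: "y * y ^ q = 1" .
    have "(y + (-1)) ^ q = y ^ q + (-1) ^ q" by (rule frobenius_add[OF q])
    then have "(y - 1) ^ q = y ^ q - 1"
      using \<open>(-1 :: 'a) ^ q = -1\<close> by simp
    then have "y * (y - 1) ^ q = - (y - 1)"
      by (simp only: right_diff_distrib y mult_1_right minus_diff_eq)
    moreover have "(y - 1) ^ q = (y - 1) ^ (q - 1) * (y - 1)"
      using q1 by (simp flip: power_Suc2)
    ultimately have "y * (y - 1) ^ (q - 1) * (y - 1) = -1 * (y - 1)"
      by (simp only: mult.assoc mult_minus1)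
    moreover have "y - 1 \<noteq> 0" using x(2) by (simp add: y_def)
    ultimately have y1: "y * (y - 1) ^ (q - 1) = -1"
      by (metis mult_right_cancel)
    let ?w = "\<theta> * x ^ r * (y - 1)"
    have "(x ^ r) ^ (q - 1) = y"
      by (simp only: y_def m power_mult[symmetric] mult.commute)
    then have "?w ^ (q - 1) = \<theta> ^ (q - 1) * (y * (y - 1) ^ (q - 1))"
      by (simp only: power_mult_distrib mult.assoc)
    also have "\<dots> = 1" unfolding \<theta>(2) y1 by simp
    finally have "?w \<in> (\<lambda>x::'a. x ^ (q + 1)) ` (-{0})"
      unfolding image_power_eq_roots(1)[OF N'] by (rule CollectI)
    then obtain u where "u \<in> -{0}" "?w = u ^ (q + 1)" by (elim imageE)
    then show ?thesis unfolding y_def by (intro exI[of _ u] conjI) simp_all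
  qed
  then obtain v where "\<And>x. x \<noteq> 0 \<Longrightarrow> x ^ m \<noteq> 1 \<Longrightarrow> v x \<noteq> 0 \<and> v x ^ (q + 1) = \<theta> * x ^ r * (x ^ m - 1)"
    by metis
  then show ?thesis by (rule that)
qed

text \<open>The evaluation points number \<open>h * m - m\<close>, as \<open>m\<close> of the
  \<open>h * m\<close> nonzero elements are \<open>m\<close>-th roots of unity. Each nonorthogonal
  pair disqualifies at most two exponents; the additive bound avoids truncated subtraction.\<close>

lemma exists_MDS_code_hull_ge:
  fixes q h r k :: nat
  assumes q: "primepow q" "CARD('a::{field,finite}) = q\<^sup>2"
    and h: "q + 1 = h * r" and n: "CARD('n::finite) = (h - 1) * ((q - 1) * r)"
    and k: "0 < k" "k \<le> CARD('n)"
  shows "\<exists>C :: ('a ^ 'n) set. MDS_code (CARD('n)) k C \<and>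
    k \<le> vec.dim (hermitian_hull q C) + 2 * card (nonorthogonal_exponents q r k)"
proof -
  define m where "m = (q - 1) * r"
  have q1: "q > 1" using primepow_gt_Suc_0[OF q(1)] by simp
  have "r > 0" "h > 0" using h by (auto intro: Nat.gr0I)
  have qq: "q\<^sup>2 - 1 = h * m"
  proof -
    have "q\<^sup>2 - 1 = (q - 1) * (q + 1)" by (simp add: power2_eq_square algebra_simps)
    then show ?thesis unfolding h m_def by (simp only: mult_ac)
  qed
  have m0: "m > 0" using q1 \<open>r > 0\<close> by (simp add: m_def)
  define S where "S = {x::'a. x \<noteq> 0 \<and> x ^ m \<noteq> 1}"
  have "card {x::'a. x ^ m = 1} = m"
    using qq q(2) m0 \<open>h > 0\<close> by (intro image_power_eq_roots(2)[of h]) auto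
  moreover have "S = -{0} - {x. x ^ m = 1}" by (auto simp: S_def)
  moreover have "{x::'a. x ^ m = 1} \<subseteq> -{0}" using m0 by (auto simp: power_0_left)
  ultimately have "card S = card (-{0::'a}) - m"
    by (simp add: card_Diff_subset)
  also have "card (-{0::'a}) = h * m"
    using qq by (simp add: q(2) Compl_eq_Diff_UNIV card_Diff_singleton)
  also have "h * m - m = CARD('n)"
    by (simp only: n m_def diff_mult_distrib mult_1)
  finally obtain e :: "'n \<Rightarrow> 'a" where "bij_betw e UNIV S"
    using finite_same_card_bij[of "UNIV :: 'n set" S] by auto
  then have e: "inj e" "range e = {x. x \<noteq> 0 \<and> x ^ m \<noteq> 1}"
    by (auto simp: bij_betw_def S_def)
  obtain \<theta> and f :: "'a \<Rightarrow> 'a" where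
    f: "\<And>x. x \<noteq> 0 \<Longrightarrow> x ^ m \<noteq> 1 \<Longrightarrow> f x \<noteq> 0 \<and> f x ^ (q + 1) = \<theta> * x ^ r * (x ^ m - 1)"
    using exists_GRS_multipliers[OF q h m_def] by blast
  have ein: "e i \<noteq> 0" "e i ^ m \<noteq> 1" for i
    using rangeI[of e i] unfolding e(2) by simp_all
  define v where "v = f \<circ> e"
  have v: "v i \<noteq> 0" "v i ^ (q + 1) = \<theta> * e i ^ r * (e i ^ m - 1)" for i
    using f[OF ein[of i]] unfolding v_def comp_apply by blast+
  let ?P = "nonorthogonal_exponents q r k"
  let ?J = "{..<k} - (fst ` ?P \<union> snd ` ?P)"
  have orth: "hermitian_form q (monomial_word v e i) (monomial_word v e j) = 0"
    if "i < k" "j \<in> ?J" for i j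
  proof (rule hermitian_form_monomial_words[OF q(2) e v(2)])
    have "(i, j) \<notin> ?P" "(j, i) \<notin> ?P"
      using that(2) image_eqI[of j snd "(i, j)" ?P] image_eqI[of j fst "(j, i)" ?P] by auto
    then have P: "\<not> q\<^sup>2 - 1 dvd i + q * j + r" "\<not> q\<^sup>2 - 1 dvd j + q * i + r"
      using that by (auto simp: nonorthogonal_exponents_def)
    then show "\<not> q\<^sup>2 - 1 dvd i + q * j + r" by blast
    have rm: "r + m = q * r" unfolding m_def using q1 by (cases q) auto
    \<comment> \<open>Multiplying by \<open>q\<close> modulo \<open>q\<^sup>2 - 1\<close> turns the
      second divisibility for \<open>(i, j)\<close> into the first one for
      \<open>(j, i)\<close>.\<close>
    have eq: "q * (i + q * j + q * r) = (j + q * i + r) + (q\<^sup>2 - 1) * (j + r)"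
    proof -
      have "q\<^sup>2 = (q\<^sup>2 - 1) + 1" using q1 by simp
      then have "q\<^sup>2 * (j + r) = (q\<^sup>2 - 1) * (j + r) + (j + r)"
        by (metis distrib_right mult_1)
      then show ?thesis by (simp only: distrib_left mult.assoc[symmetric] power2_eq_square add_ac)
    qed
    show "\<not> q\<^sup>2 - 1 dvd i + q * j + (r + m)"
    proof
      assume "q\<^sup>2 - 1 dvd i + q * j + (r + m)"
      then have "q\<^sup>2 - 1 dvd q * (i + q * j + q * r)"
        unfolding rm by (rule dvd_mult)
      then have "q\<^sup>2 - 1 dvd j + q * i + r"
        unfolding eq by (simp only: dvd_add_left_iff[OF dvd_triv_left])
      with P(2) show False by blast
    qed
  qed
  have J: "card ?J \<le> vec.dim (hermitian_hull q (GRS_code v e k))"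
    using dim_hermitian_hull_GRS_code_ge[OF e(1) v(1) k(2) Diff_subset orth] .
  have "card {..<k} - card (fst ` ?P \<union> snd ` ?P) \<le> card ?J"
    by (intro diff_card_le_card_Diff finite_UnI finite_imageI finite_nonorthogonal_exponents)
  moreover have "card (fst ` ?P \<union> snd ` ?P) \<le> card (fst ` ?P) + card (snd ` ?P)"
    by (rule card_Un_le)
  moreover have "card (fst ` ?P) \<le> card ?P" "card (snd ` ?P) \<le> card ?P"
    by (intro card_image_le finite_nonorthogonal_exponents)+
  ultimately have "k \<le> vec.dim (hermitian_hull q (GRS_code v e k)) + 2 * card ?P"
    using J unfolding card_lessThan by linarith
  with MDS_code_GRS_code[OF e(1) v(1) k] show ?thesis
    by (intro exI[of _ "GRS_code v e k"] conjI)
qed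

theorem theorem4:
  fixes q h n :: nat and t k l :: int
  assumes "primepow q" and "q > 2"
    and "CARD('a::{field,finite}) = q\<^sup>2"
    and "h dvd q + 1" and "h \<ge> 2"
    and "n = (h - 1) * (q\<^sup>2 - 1) div h"
    and "CARD('n::finite) = n"
    and "1 \<le> t" and "t \<le> \<lceil>real n / (2 * real q)\<rceil>"
    and "hull_parameters (int q) (int h) t k l"
  shows "\<forall>s::nat. int s \<le> l \<longrightarrow>
           (\<exists>C :: ('a ^ 'n) set. MDS_code n (nat k) C \<and> vec.dim (hermitian_hull q C) = s)"
proof -
  obtain r where r: "q + 1 = h * r" using assms(4) by (auto elim: dvdE)
  let ?Q = "int q" and ?R = "int r"
  have r0: "0 < r" using r by (auto intro: Nat.gr0I)
  have rQ: "0 < ?R" "2 < ?Q" using r0 assms(2) by simp_all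
  have "2 * r \<le> h * r" using assms(5) by simp
  then have r2: "2 * ?R \<le> ?Q + 1" using r by linarith
  \<comment> \<open>\<open>a\<close> is \<open>(h - 1) * r\<close>, the quotient in
    \<open>hull_parameters\<close>; also \<open>n = a * (q - 1)\<close>.\<close>
  define a where "a = ?Q + 1 - ?R"
  have "(int h - 1) * (?Q + 1) = (int h - 1) * ?R * int h"
    using arg_cong[OF r, of int] by (simp add: mult_ac)
  then have "(int h - 1) * (?Q + 1) div int h = (int h - 1) * ?R"
    using assms(5) by simp
  also have "\<dots> = a"
    using arg_cong[OF r, of int] by (simp add: a_def algebra_simps)
  finally have div_h: "(int h - 1) * (?Q + 1) div int h = a" .
  have n: "n = (h - 1) * ((q - 1) * r)"
  proof -
    have "q\<^sup>2 - 1 = (q - 1) * (q + 1)" by (simp add: power2_eq_square algebra_simps)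
    then have "(h - 1) * (q\<^sup>2 - 1) = (h - 1) * ((q - 1) * r) * h"
      unfolding r by (simp only: mult_ac)
    then show ?thesis using assms(5,6) by simp
  qed
  then have "int n = (int h - 1) * ?R * (?Q - 1)"
    using assms(2,5) by (simp add: of_nat_diff mult_ac)
  also have "(int h - 1) * ?R = a"
    using arg_cong[OF r, of int] by (simp add: a_def algebra_simps)
  finally have na: "int n = a * (?Q - 1)" .
  have a0: "0 < a" using r2 assms(2) by (simp add: a_def)
  \<comment> \<open>\<open>2 * q * (t - 1) < n = a * (q - 1) < a * q\<close>.\<close>
  have t: "2 * t \<le> a + 1"
  proof -
    have "real_of_int (t - 1) < real n / (2 * real q)"
      using assms(9) by linarith
    then have "real_of_int (t - 1) * (2 * real q) < real n"
      using assms(2) by (simp add: pos_less_divide_eq)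
    then have "real_of_int ((t - 1) * 2 * ?Q) < real_of_int (int n)"
      by (simp add: mult_ac)
    then have "(t - 1) * 2 * ?Q < int n" by (simp only: of_int_less_iff)
    also have "\<dots> < a * ?Q"
      unfolding na using a0 by (simp add: algebra_simps)
    finally have "(t - 1) * 2 < a"
      using assms(2) by simp
    then show ?thesis by simp
  qed
  note hp = assms(10)[unfolded hull_parameters_def div_h Let_def]
  \<comment> \<open>The second range starts at \<open>(t - 1) * (q - 1) + r\<close>, positive though
    possibly below \<open>(t - 1) * q\<close>.\<close>
  have k1: "1 \<le> k"
  proof -
    have "t - 1 \<le> (t - 1) * ?Q"
      using mult_left_mono[of 1 ?Q "t - 1"] assms(2,8) by simp
    moreover have "(t - 1) * ?Q = t * ?Q - ?Q" by (simp add: algebra_simps)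
    ultimately show ?thesis
      using hp rQ assms(8) unfolding a_def by (elim disjE conjE) linarith+
  qed
  have kn: "k \<le> int n"
  proof -
    have "k \<le> t * ?Q" using hp a0 assms(8) by auto
    also have "t * ?Q \<le> a * (?Q - 1)"
    proof (cases "t = 1")
      case True
      have "?Q \<le> 2 * (?Q - 1)" using rQ by simp
      also have "\<dots> \<le> a * (?Q - 1)"
        using r2 assms(2) by (intro mult_right_mono) (auto simp: a_def)
      finally show ?thesis using True by simp
    next
      case False
      then have "3 \<le> a" using t assms(8) by linarith
      \<comment> \<open>By \<open>2 * t \<le> a + 1\<close> it suffices that
        \<open>(a + 1) * q \<le> 2 * a * (q - 1)\<close>; the difference is
        \<open>(a - 3) * (q - 3) + (a + 2 * q - 9)\<close>.\<close>
      then have "0 \<le> (a - 3) * (?Q - 3)" using assms(2) by simp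
      moreover have "2 * t * ?Q \<le> (a + 1) * ?Q"
        using t by (intro mult_right_mono) auto
      ultimately show ?thesis
        using \<open>3 \<le> a\<close> assms(2) by (simp add: algebra_simps)
    qed
    finally show ?thesis by (simp add: na)
  qed
  obtain C :: "('a ^ 'n) set" where C: "MDS_code n (nat k) C"
    and hull: "nat k \<le> vec.dim (hermitian_hull q C) + 2 * card (nonorthogonal_exponents q r (nat k))"
  proof -
    have "CARD('n) = (h - 1) * ((q - 1) * r)" using n assms(7) by (simp only:)
    moreover have "0 < nat k" "nat k \<le> CARD('n)" using k1 kn assms(7) by linarith+
    ultimately have "\<exists>C :: ('a ^ 'n) set. MDS_code (CARD('n)) (nat k) C \<and>
        nat k \<le> vec.dim (hermitian_hull q C) + 2 * card (nonorthogonal_exponents q r (nat k))"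
      by (rule exists_MDS_code_hull_ge[OF assms(1,3) r])
    then show ?thesis using that unfolding assms(7) by blast
  qed
  have "l \<le> k - 2 * int (card (nonorthogonal_exponents q r (nat k)))"
    using hull_parameters_card_nonorthogonal_exponents[OF _ r0 r2 _ assms(8) _ _ a_def div_h assms(10), where k' = "nat k"]
      t k1 r2 assms(2) by (simp add: a_def)
  then have "l \<le> int (vec.dim (hermitian_hull q C))"
    using hull k1 by linarith
  then show ?thesis
    using MDS_code_reduce_hull[OF assms(1-3) C] by simp
qed

end
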